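(* Let $(T,F)$ be a rooted tree with a sink over $(Q,\rho)$ and $M:=M(T,F)$. Let $\iota:T\to T$ be a non-identity idempotent quiver morphism satisfying $F\circ\iota=F$. Set $\mathrm{Fix}(\iota):=\{n\in T_0\mid\iota(n)=n\}$ and let $T^1,\dots,T^k$ be the partition of $T_0\setminus\mathrm{Fix}(\iota)$ such that $\langle T^1\rangle,\dots,\langle T^k\rangle$ are the connected components of $\langle T_0\setminus\mathrm{Fix}(\iota)\rangle$. Put $M_0:=M(\langle\mathrm{Fix}(\iota)\rangle,F|_{\langle\mathrm{Fix}(\iota)\rangle})$ and $M_j:=M(\langle T^j\rangle,F|_{\langle T^j\rangle})$ for $1\le j\le k$. Then $M\cong\bigoplus_{j=0}^kM_j$ as $\Lambda$-modules.
   Context: Fix a field $\mathcal K$ with $\mathrm{char}(\mathcal K)\neq 2$. Let $Q=(Q_0,Q_1,\varsigma,\varepsilon)$ be a quiver and $\rho$ a set of paths in $Q$ of length at least $2$ that bounds the length of the paths, not lying in the ideal $\langle\rho\rangle$, passing through any vertex. Put $\Lambda:=\mathcal KQ/\langle\rho\rangle$. Finite-dimensional $\Lambda$-modules are identified with finite-dimensional $\mathcal K$-representations of $(Q,\rho)$. A tree is a finite quiver $T=(T_0,T_1,s,t)$ whose underlying undirected graph is connected without cycles. Here rooted trees have a unique sink $\ast$ (the root). For $X\subseteq T_0$, $\langle X\rangle$ denotes the subquiver (subforest) of $T$ induced by $X$. With the notation of the claim, $\langle\mathrm{Fix}(\iota)\rangle$ is a subtree of $T$ with sink $\ast$ and each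 $\langle T^j\rangle$ is a rooted tree with a sink. A quiver morphism is a pair of maps (on vertices and on arrows) commuting with sources and targets. A quiver morphism $F:T\to Q$ is bound, written $F:T\to(Q,\rho)$, if there is no path $p$ in $T$ with $F(p)\in\langle\rho\rangle$; then $(T,F)$ is a tree over $(Q,\rho)$. The rooted tree module $M(T,F)$ is the $\Lambda$-module with $\mathcal K$-basis $\{v_n\mid n\in T_0\}$, with $v_n$ at the vertex $F(n)$, where $\gamma\in Q_1$ acts by $\gamma\cdot v_n=\sum_{a\in T_1,\ s(a)=n,\ F(a)=\gamma}v_{t(a)}$. *)

theory Defs
  imports
    "Graph_Theory.Digraph_Component"
    "HOL-Library.Function_Algebras"
    "HOL-Library.Poly_Mapping"
    "HOL-Library.Disjoint_Sets"
begin

section \<open>Quivers, paths and the path algebra\<close>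

text \<open>
  Quivers are well-formed digraphs (\<^locale>\<open>wf_digraph\<close>): loops, parallel arrows and infinitely
  many vertices or arrows are allowed; \<^const>\<open>tail\<close> is the source and \<^const>\<open>head\<close> the target.

  A path is its starting vertex together with the list of its arrows in the order of traversal,
  so \<open>(u, [])\<close> is the trivial path at \<open>u\<close>.
\<close>

type_synonym ('q, 'a) qpath = "'q \<times> 'a list"

definition qpath_end :: "('q, 'a) pre_digraph \<Rightarrow> ('q, 'a) qpath \<Rightarrow> 'q" where
  "qpath_end Q p = pre_digraph.awlast Q (fst p) (snd p)"

definition qpaths :: "('q, 'a) pre_digraph \<Rightarrow> ('q, 'a) qpath set" where
  "qpaths Q = {p. pre_digraph.awalk Q (fst p) (snd p) (qpath_end Q p)}"

definition path_algebra :: "('q, 'a) pre_digraph \<Rightarrow> (('q, 'a) qpath \<Rightarrow>\<^sub>0 'k::field) set" where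
  "path_algebra Q = {f. Poly_Mapping.keys f \<subseteq> qpaths Q}"

text \<open>
  Multiplication follows the convention for left modules: the product of the paths \<open>p\<close> and \<open>q\<close> is
  the path that first runs through \<open>q\<close> and then through \<open>p\<close>, and \<open>0\<close> if they do not fit together.
\<close>

definition path_mult ::
  "('q, 'a) pre_digraph \<Rightarrow> (('q, 'a) qpath \<Rightarrow>\<^sub>0 'k::field) \<Rightarrow> (('q, 'a) qpath \<Rightarrow>\<^sub>0 'k)
    \<Rightarrow> (('q, 'a) qpath \<Rightarrow>\<^sub>0 'k)" where
  "path_mult Q f g =
    (\<Sum>p\<in>Poly_Mapping.keys f. \<Sum>q\<in>Poly_Mapping.keys g.
      if qpath_end Q q = fst p
      then Poly_Mapping.single (fst q, snd q @ snd p)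
             (Poly_Mapping.lookup f p * Poly_Mapping.lookup g q)
      else 0)"

text \<open>
  The path algebra has no unit if there are infinitely many vertices, so closure under scalars is
  part of the definition of an ideal.
\<close>

definition path_algebra_ideal ::
  "('q, 'a) pre_digraph \<Rightarrow> (('q, 'a) qpath \<Rightarrow>\<^sub>0 'k::field) set \<Rightarrow> bool" where
  "path_algebra_ideal Q I \<longleftrightarrow>
    I \<subseteq> path_algebra Q \<and> 0 \<in> I \<and>
    (\<forall>x\<in>I. \<forall>y\<in>I. x + y \<in> I) \<and>
    (\<forall>c. \<forall>x\<in>I. Poly_Mapping.map ((*) c) x \<in> I) \<and>
    (\<forall>f\<in>path_algebra Q. \<forall>x\<in>I. path_mult Q f x \<in> I \<and> path_mult Q x f \<in> I)"

abbreviation path_elem :: "('q, 'a) qpath \<Rightarrow> (('q, 'a) qpath \<Rightarrow>\<^sub>0 'k::field)" where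
  "path_elem p \<equiv> Poly_Mapping.single p 1"

definition generated_ideal ::
  "('q, 'a) pre_digraph \<Rightarrow> ('q, 'a) qpath set \<Rightarrow> (('q, 'a) qpath \<Rightarrow>\<^sub>0 'k::field) set" where
  "generated_ideal Q \<rho> = \<Inter> {I. path_algebra_ideal Q I \<and> path_elem ` \<rho> \<subseteq> I}"

text \<open>The length bound may depend on the vertex.\<close>

definition bound_quiver ::
  "'k::field itself \<Rightarrow> ('q, 'a) pre_digraph \<Rightarrow> ('q, 'a) qpath set \<Rightarrow> bool" where
  "bound_quiver K Q \<rho> \<longleftrightarrow>
    wf_digraph Q \<and> \<rho> \<subseteq> qpaths Q \<and> (\<forall>p\<in>\<rho>. 2 \<le> length (snd p)) \<and>
    (\<forall>v\<in>verts Q. \<exists>N. \<forall>p\<in>qpaths Q.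
       v \<in> set (pre_digraph.awalk_verts Q (fst p) (snd p)) \<and>
       (path_elem p :: ('q, 'a) qpath \<Rightarrow>\<^sub>0 'k) \<notin> generated_ideal Q \<rho>
       \<longrightarrow> length (snd p) \<le> N)"

section \<open>Quiver morphisms\<close>

record ('n, 'e, 'q, 'a) quiver_map =
  vmap :: "'n \<Rightarrow> 'q"
  amap :: "'e \<Rightarrow> 'a"

definition quiver_morphism ::
  "('n, 'e) pre_digraph \<Rightarrow> ('q, 'a) pre_digraph \<Rightarrow> ('n, 'e, 'q, 'a) quiver_map \<Rightarrow> bool" where
  "quiver_morphism S Q f \<longleftrightarrow>
    (\<forall>n\<in>verts S. vmap f n \<in> verts Q) \<and>
    (\<forall>e\<in>arcs S. amap f e \<in> arcs Q \<and>
       tail Q (amap f e) = vmap f (tail S e) \<and> head Q (amap f e) = vmap f (head S e))"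

definition quiver_comp ::
  "('m, 'd, 'q, 'a) quiver_map \<Rightarrow> ('n, 'e, 'm, 'd) quiver_map \<Rightarrow> ('n, 'e, 'q, 'a) quiver_map" where
  "quiver_comp g f = \<lparr>vmap = vmap g \<circ> vmap f, amap = amap g \<circ> amap f\<rparr>"

definition quiver_id :: "('n, 'e, 'n, 'e) quiver_map" where
  "quiver_id = \<lparr>vmap = id, amap = id\<rparr>"

text \<open>Morphisms out of \<open>S\<close> are equal if they agree on \<open>S\<close>; values elsewhere are irrelevant.\<close>

definition quiver_map_eq ::
  "('n, 'e) pre_digraph \<Rightarrow> ('n, 'e, 'q, 'a) quiver_map \<Rightarrow> ('n, 'e, 'q, 'a) quiver_map \<Rightarrow> bool" where
  "quiver_map_eq S f g \<longleftrightarrow>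
    (\<forall>n\<in>verts S. vmap f n = vmap g n) \<and> (\<forall>e\<in>arcs S. amap f e = amap g e)"

definition map_qpath :: "('n, 'e, 'q, 'a) quiver_map \<Rightarrow> ('n, 'e) qpath \<Rightarrow> ('q, 'a) qpath" where
  "map_qpath f p = (vmap f (fst p), map (amap f) (snd p))"

definition bound_morphism ::
  "'k::field itself \<Rightarrow> ('n, 'e) pre_digraph \<Rightarrow> ('q, 'a) pre_digraph \<Rightarrow> ('q, 'a) qpath set
    \<Rightarrow> ('n, 'e, 'q, 'a) quiver_map \<Rightarrow> bool" where
  "bound_morphism K T Q \<rho> F \<longleftrightarrow>
    quiver_morphism T Q F \<and>
    \<not> (\<exists>p\<in>qpaths T.
        (path_elem (map_qpath F p) :: ('q, 'a) qpath \<Rightarrow>\<^sub>0 'k) \<in> generated_ideal Q \<rho>)"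

section \<open>Trees and connected components\<close>

text \<open>
  Walks in \<open>doubled G\<close> are the walks in the underlying undirected multigraph of \<open>G\<close>: the arc
  \<open>(e, True)\<close> runs through \<open>e\<close> forwards, \<open>(e, False)\<close> backwards.
\<close>

definition doubled :: "('n, 'e) pre_digraph \<Rightarrow> ('n, 'e \<times> bool) pre_digraph" where
  "doubled G = \<lparr>verts = verts G, arcs = arcs G \<times> UNIV,
     tail = (\<lambda>(e, fwd). if fwd then tail G e else head G e),
     head = (\<lambda>(e, fwd). if fwd then head G e else tail G e)\<rparr>"

text \<open>
  An undirected cycle uses every arrow at most once, so going back and forth along one arrow does
  not count, whereas loops and pairs of parallel or opposite arrows do. The predicate
  \<^const>\<open>forest\<close> of the library only excludes directed cycles; \<^const>\<open>connected\<close> is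
  connectedness of the underlying undirected graph.
\<close>

definition undirected_cycle :: "('n, 'e) pre_digraph \<Rightarrow> ('e \<times> bool) list \<Rightarrow> bool" where
  "undirected_cycle G c \<longleftrightarrow> pre_digraph.cycle (doubled G) c \<and> distinct (map fst c)"

definition tree_quiver :: "('n, 'e) pre_digraph \<Rightarrow> bool" where
  "tree_quiver T \<longleftrightarrow> fin_digraph T \<and> connected T \<and> \<not> (\<exists>c. undirected_cycle T c)"

definition rooted_tree :: "('n, 'e) pre_digraph \<Rightarrow> bool" where
  "rooted_tree T \<longleftrightarrow> tree_quiver T \<and> (\<exists>!r. r \<in> verts T \<and> out_arcs T r = {})"

definition connected_components :: "('n, 'e) pre_digraph \<Rightarrow> ('n, 'e) pre_digraph set" where
  "connected_components G =
    {H. induced_subgraph H G \<and> connected H \<and>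
        \<not> (\<exists>H'. induced_subgraph H' G \<and> connected H' \<and> verts H \<subset> verts H')}"

definition fixed_verts :: "('n, 'e) pre_digraph \<Rightarrow> ('n, 'e, 'n, 'e) quiver_map \<Rightarrow> 'n set" where
  "fixed_verts T \<iota> = {n \<in> verts T. vmap \<iota> n = n}"

section \<open>Representations of bound quivers\<close>

text \<open>
  Finite-dimensional modules over \<open>KQ/\<langle>\<rho>\<rangle>\<close> are identified with finite-dimensional
  representations of \<open>(Q, \<rho>)\<close>. The spaces at the vertices are subspaces of one ambient vector space
  on the type \<open>'v\<close>; they need not be independent there.
\<close>

record ('q, 'a, 'k, 'v) quiver_rep =
  rep_scale :: "'k \<Rightarrow> 'v \<Rightarrow> 'v"
  rep_space :: "'q \<Rightarrow> 'v set"
  rep_map :: "'a \<Rightarrow> 'v \<Rightarrow> 'v"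

definition linear_between ::
  "('k \<Rightarrow> 'v \<Rightarrow> 'v) \<Rightarrow> ('k \<Rightarrow> 'w \<Rightarrow> 'w) \<Rightarrow> 'v::ab_group_add set \<Rightarrow> 'w::ab_group_add set
    \<Rightarrow> ('v \<Rightarrow> 'w) \<Rightarrow> bool" where
  "linear_between s t A B f \<longleftrightarrow>
    (\<forall>x\<in>A. f x \<in> B) \<and> (\<forall>x\<in>A. \<forall>y\<in>A. f (x + y) = f x + f y) \<and>
    (\<forall>c. \<forall>x\<in>A. f (s c x) = t c (f x))"

definition rep_path_map :: "('q, 'a, 'k, 'v) quiver_rep \<Rightarrow> ('q, 'a) qpath \<Rightarrow> 'v \<Rightarrow> 'v" where
  "rep_path_map V p = fold (rep_map V) (snd p)"

definition fd_representation ::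
  "('q, 'a) pre_digraph \<Rightarrow> ('q, 'a) qpath set
    \<Rightarrow> ('q, 'a, 'k::field, 'v::ab_group_add) quiver_rep \<Rightarrow> bool" where
  "fd_representation Q \<rho> V \<longleftrightarrow>
    vector_space (rep_scale V) \<and>
    (\<forall>i\<in>verts Q. module.subspace (rep_scale V) (rep_space V i)) \<and>
    (\<forall>a\<in>arcs Q. linear_between (rep_scale V) (rep_scale V)
       (rep_space V (tail Q a)) (rep_space V (head Q a)) (rep_map V a)) \<and>
    (\<forall>p\<in>\<rho>. \<forall>x\<in>rep_space V (fst p). rep_path_map V p x = 0) \<and>
    (\<forall>i\<in>verts Q. \<exists>B. finite B \<and> module.span (rep_scale V) B = rep_space V i) \<and>
    finite {i \<in> verts Q. rep_space V i \<noteq> {0}}"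

definition rep_hom ::
  "('q, 'a) pre_digraph \<Rightarrow> ('q, 'a, 'k, 'v::ab_group_add) quiver_rep
    \<Rightarrow> ('q, 'a, 'k, 'w::ab_group_add) quiver_rep \<Rightarrow> ('q \<Rightarrow> 'v \<Rightarrow> 'w) \<Rightarrow> bool" where
  "rep_hom Q V W \<phi> \<longleftrightarrow>
    (\<forall>i\<in>verts Q. linear_between (rep_scale V) (rep_scale W) (rep_space V i) (rep_space W i) (\<phi> i)) \<and>
    (\<forall>a\<in>arcs Q. \<forall>x\<in>rep_space V (tail Q a).
       \<phi> (head Q a) (rep_map V a x) = rep_map W a (\<phi> (tail Q a) x))"

text \<open>Isomorphism in the category of finite-dimensional representations of \<open>(Q, \<rho>)\<close>.\<close>

definition rep_iso ::
  "('q, 'a) pre_digraph \<Rightarrow> ('q, 'a) qpath set \<Rightarrow> ('q, 'a, 'k::field, 'v::ab_group_add) quiver_rep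
    \<Rightarrow> ('q, 'a, 'k, 'w::ab_group_add) quiver_rep \<Rightarrow> bool" where
  "rep_iso Q \<rho> V W \<longleftrightarrow>
    fd_representation Q \<rho> V \<and> fd_representation Q \<rho> W \<and>
    (\<exists>\<phi>. rep_hom Q V W \<phi> \<and> (\<forall>i\<in>verts Q. bij_betw (\<phi> i) (rep_space V i) (rep_space W i)))"

text \<open>
  Direct sum over a finite index set \<open>J\<close>; its elements vanish outside \<open>J\<close>. As the ambient
  space is all of \<open>'j \<Rightarrow> 'v\<close>, the scalar multiplication of \<open>N j\<close> has to be that of a vector
  space also for \<open>j \<notin> J\<close>.
\<close>

definition rep_sum ::
  "'j set \<Rightarrow> ('j \<Rightarrow> ('q, 'a, 'k, 'v::ab_group_add) quiver_rep)
    \<Rightarrow> ('q, 'a, 'k, 'j \<Rightarrow> 'v) quiver_rep" where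
  "rep_sum J N = \<lparr>
     rep_scale = (\<lambda>c x j. rep_scale (N j) c (x j)),
     rep_space = (\<lambda>i. {x. (\<forall>j\<in>J. x j \<in> rep_space (N j) i) \<and> (\<forall>j. j \<notin> J \<longrightarrow> x j = 0)}),
     rep_map = (\<lambda>a x j. if j \<in> J then rep_map (N j) a (x j) else 0)\<rparr>"

section \<open>Tree modules\<close>

definition basis_vec :: "'n \<Rightarrow> 'n \<Rightarrow> 'k::field" where
  "basis_vec n = (\<lambda>m. if m = n then 1 else 0)"

text \<open>
  A vector \<open>x\<close> stands for the linear combination of the \<open>basis_vec n\<close> with coefficients \<open>x n\<close>,
  where \<open>n\<close> ranges over the vertices of \<open>T\<close>.
\<close>

definition tree_module ::
  "('n, 'e) pre_digraph \<Rightarrow> ('n, 'e, 'q, 'a) quiver_map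
    \<Rightarrow> ('q, 'a, 'k::field, 'n \<Rightarrow> 'k) quiver_rep" where
  "tree_module T F = \<lparr>
     rep_scale = (\<lambda>c x n. c * x n),
     rep_space = (\<lambda>i. {x. \<forall>n. x n \<noteq> 0 \<longrightarrow> n \<in> verts T \<and> vmap F n = i}),
     rep_map = (\<lambda>\<gamma> x. \<Sum>n\<in>verts T.
       (\<lambda>m. x n * (\<Sum>e\<in>{e \<in> arcs T. tail T e = n \<and> amap F e = \<gamma>}. basis_vec (head T e)) m))\<rparr>"

end

theory Submission
  imports Defs
begin

text \<open>
  In a rooted tree every vertex has at most one outgoing arrow, so \<open>\<iota>\<close> fixes the root, and
  \<open>Fix(\<iota>)\<close> is closed under following arrows. Hence \<open>v\<^sub>n \<mapsto> v\<^sub>\<iota>\<^sub>(\<^sub>n\<^sub>)\<close> is a retraction of \<open>M\<close>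
  onto the submodule \<open>M\<^sub>0\<close>. Its kernel has the basis \<open>v\<^sub>n - v\<^sub>\<iota>\<^sub>(\<^sub>n\<^sub>)\<close>, \<open>n \<notin> Fix(\<iota>)\<close>, on which the
  arrows act as on \<open>M\<^sub>1 \<oplus> \<dots> \<oplus> M\<^sub>k\<close>, since an arrow leaving a component ends in \<open>Fix(\<iota>)\<close>. The
  resulting isomorphism sends \<open>v\<^sub>n\<close> with \<open>n \<in> T\<^sup>j\<close> to \<open>v\<^sub>n \<in> M\<^sub>j\<close> plus \<open>v\<^sub>\<iota>\<^sub>(\<^sub>n\<^sub>) \<in> M\<^sub>0\<close>.
\<close>

section \<open>Arrows in rooted trees and components\<close>

lemma doubled_simps [simp]:
  "verts (doubled G) = verts G" "arcs (doubled G) = arcs G \<times> UNIV"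
  "tail (doubled G) (e, b) = (if b then tail G e else head G e)"
  "head (doubled G) (e, b) = (if b then head G e else tail G e)"
  by (simp_all add: doubled_def)

lemma wf_digraph_doubled:
  assumes "wf_digraph G"
  shows "wf_digraph (doubled G)"
proof -
  interpret wf_digraph G by (fact assms)
  show ?thesis by unfold_locales (auto split: if_splits)
qed

text \<open>If the first arrow occurred again in either direction, both its end points would lie on
  the rest of the path. The starting vertex is one of them, and \<open>apath\<close> forbids
  returning to it. This supplies the distinctness demanded by
  \<open>undirected_cycle\<close>.\<close>

lemma doubled_apath_distinct_arcs:
  assumes "wf_digraph G" "pre_digraph.apath (doubled G) u p v"
  shows "distinct (map fst p)"
  using assms(2)
proof (induction p arbitrary: u)
  case (Cons x p)
  interpret D: wf_digraph "doubled G" using assms(1) by (rule wf_digraph_doubled)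
  obtain e b where x: "x = (e, b)" by fastforce
  have u: "u = tail (doubled G) x" "u \<notin> set (D.awalk_verts (head (doubled G) x) p)"
    and p: "D.apath (head (doubled G) x) p v"
    using Cons.prems by (auto simp: D.apath_Cons_iff)
  have "(e, b') \<notin> set p" for b'
  proof
    assume "(e, b') \<in> set p"
    then have "{tail G e, head G e} \<subseteq> set (D.awalk_verts (head (doubled G) x) p)"
      using p by (cases b') (force simp: D.set_awalk_verts[of _ _ v] D.apath_def)+
    with u show False by (simp add: x split: if_splits)
  qed
  with Cons.IH[OF p] show ?case by (auto simp: x)
qed simp

text \<open>A connection of the end points that avoids \<open>e\<close> can be shortened to a path
  without repeated vertices, and \<open>e\<close> closes it to a cycle. If \<open>e\<close> is a
  loop, the path is empty and \<open>e\<close> alone is the cycle.\<close>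

lemma no_undirected_cycle_imp_bridge:
  assumes G: "wf_digraph G" and acyc: "\<not> (\<exists>c. undirected_cycle G c)" and e: "e \<in> arcs G"
    and A: "A = (\<lambda>a. (tail G a, head G a)) ` (arcs G - {e})"
  shows "(head G e, tail G e) \<notin> (A \<union> A\<inverse>)\<^sup>*"
proof
  interpret wf_digraph G by (fact G)
  interpret D: wf_digraph "doubled G" using G by (rule wf_digraph_doubled)
  assume "(head G e, tail G e) \<in> (A \<union> A\<inverse>)\<^sup>*"
  then have "\<exists>p. D.awalk (head G e) p (tail G e) \<and> e \<notin> fst ` set p"
  proof (induction rule: converse_rtrancl_induct)
    case base
    show ?case using e by (intro exI[of _ "[]"]) (auto simp: D.awalk_Nil_iff)
  next
    case (step u w)
    then obtain p where p: "D.awalk w p (tail G e)" "e \<notin> fst ` set p" by blast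
    from step.hyps(1) obtain x where
      "x \<in> arcs (doubled G)" "tail (doubled G) x = u" "head (doubled G) x = w" "fst x \<noteq> e"
    proof
      assume "(u, w) \<in> A"
      then show thesis using that[of "(a, True)" for a] by (auto simp: A)
    next
      assume "(u, w) \<in> A\<inverse>"
      then show thesis using that[of "(a, False)" for a] by (auto simp: A)
    qed
    with p show ?case by (intro exI[of _ "x # p"]) (auto simp: D.awalk_Cons_iff)
  qed
  then obtain p where p: "D.awalk (head G e) p (tail G e)" "e \<notin> fst ` set p" by blast
  \<comment> \<open>The shortening uses only arrows of \<open>p\<close>, so it still avoids
    \<open>e\<close>.\<close>
  define q where "q = D.awalk_to_apath p"
  have q: "D.apath (head G e) q (tail G e)" "e \<notin> fst ` set q"
    using D.apath_awalk_to_apath[OF p(1)] D.awalk_to_apath_subset[OF p(1)] p(2)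
    by (auto simp: q_def)
  have "undirected_cycle G ((e, True) # q)"
    unfolding undirected_cycle_def D.cycle_def
    using q e doubled_apath_distinct_arcs[OF G q(1)]
    by (auto simp: D.apath_def D.awalk_Cons_iff intro!: exI[of _ "tail G e"])
  with acyc show False by blast
qed

text \<open>A directed cycle through \<open>e\<close> leads from the head of \<open>e\<close> back
  to its tail. Stopped at its first visit to \<open>tail G e\<close>, this return route avoids
  \<open>e\<close>, so \<open>e\<close> is not a bridge.\<close>

lemma no_undirected_cycle_imp_acyclic:
  assumes G: "wf_digraph G" and acyc: "\<not> (\<exists>c. undirected_cycle G c)"
  shows "acyclic (arcs_ends G)"
proof (rule acyclicI, intro allI notI)
  fix u assume "(u, u) \<in> (arcs_ends G)\<^sup>+"
  then obtain v where "(u, v) \<in> arcs_ends G" "(v, u) \<in> (arcs_ends G)\<^sup>*"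
    by (auto dest: tranclD)
  then obtain e where e: "e \<in> arcs G" and "(head G e, tail G e) \<in> (arcs_ends G)\<^sup>*"
    by (auto simp: arcs_ends_def arc_to_ends_def)
  let ?A = "(\<lambda>a. (tail G a, head G a)) ` (arcs G - {e})"
  have "(x, tail G e) \<in> ?A\<^sup>*" if "(x, tail G e) \<in> (arcs_ends G)\<^sup>*" for x
    using that
  proof (induction rule: converse_rtrancl_induct)
    case (step x y)
    then obtain a where "a \<in> arcs G" "tail G a = x" "head G a = y"
      by (auto simp: arcs_ends_def arc_to_ends_def)
    show ?case
    \<comment> \<open>If the next arrow is \<open>e\<close>, then \<open>x\<close> is already the
      target and the trivial route suffices.\<close>
    proof (cases "a = e")
      case False
      with \<open>a \<in> arcs G\<close> \<open>tail G a = x\<close> \<open>head G a = y\<close> have "(x, y) \<in> ?A" by blast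
      then show ?thesis using step.IH by (rule converse_rtrancl_into_rtrancl)
    qed (use \<open>tail G a = x\<close> in simp)
  qed simp
  from this[OF \<open>(head G e, tail G e) \<in> (arcs_ends G)\<^sup>*\<close>]
  have "(head G e, tail G e) \<in> (?A \<union> ?A\<inverse>)\<^sup>*"
    by (rule subsetD[OF rtrancl_mono, rotated]) blast
  with no_undirected_cycle_imp_bridge[OF G acyc e refl] show False by blast
qed

text \<open>Following arrows in a finite acyclic quiver must stop, and it can only stop at the
  unique sink; hence the induction along reversed arrows.\<close>

lemma rooted_tree_reaches_root:
  assumes T: "rooted_tree T" and r: "r \<in> verts T" "out_arcs T r = {}" and n: "n \<in> verts T"
  shows "(n, r) \<in> (arcs_ends T)\<^sup>*"
proof -
  interpret fin_digraph T using T by (simp add: rooted_tree_def tree_quiver_def)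
  have "acyclic (arcs_ends T)"
    using T wf_digraph_axioms
    by (intro no_undirected_cycle_imp_acyclic) (auto simp: rooted_tree_def tree_quiver_def)
  then have "wf ((arcs_ends T)\<inverse>)"
    by (intro finite_acyclic_wf_converse) (simp_all add: arcs_ends_def)
  then show ?thesis using n
  proof (induction n)
    case (less n)
    show ?case
    proof (cases "n = r")
      case False
      then have "out_arcs T n \<noteq> {}"
        using T r less.prems unfolding rooted_tree_def by blast
      then obtain e where e: "e \<in> arcs T" "tail T e = n" by (auto simp: out_arcs_def)
      then have "(n, head T e) \<in> arcs_ends T" by (auto simp: arcs_ends_def arc_to_ends_def)
      moreover from this have "(head T e, r) \<in> (arcs_ends T)\<^sup>*" using less.IH e by simp
      ultimately show ?thesis by (rule converse_rtrancl_into_rtrancl)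
    qed simp
  qed
qed

text \<open>Two arrows out of \<open>tail e\<close> would lead to the root along two routes, of which the second avoids
  \<open>e\<close>; so the end points of \<open>e\<close> would stay connected without \<open>e\<close>.\<close>

lemma rooted_tree_unique_out_arc:
  assumes T: "rooted_tree T" and e: "e \<in> arcs T" and f: "f \<in> arcs T"
    and tails: "tail T e = tail T f"
  shows "e = f"
proof (rule ccontr)
  assume "e \<noteq> f"
  interpret fin_digraph T using T by (simp add: rooted_tree_def tree_quiver_def)
  have acyc: "\<not> (\<exists>c. undirected_cycle T c)" using T by (simp add: rooted_tree_def tree_quiver_def)
  have acyclic: "acyclic (arcs_ends T)"
    by (rule no_undirected_cycle_imp_acyclic[OF wf_digraph_axioms acyc])
  from T obtain r where r: "r \<in> verts T" "out_arcs T r = {}" by (auto simp: rooted_tree_def)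
  let ?A = "(\<lambda>a. (tail T a, head T a)) ` (arcs T - {e})"
  \<comment> \<open>A route starting strictly after \<open>tail T e\<close> cannot use
    \<open>e\<close>, since returning to \<open>tail T e\<close> would contradict
    acyclicity.\<close>
  have avoid: "(x, r) \<in> ?A\<^sup>*"
    if "(x, r) \<in> (arcs_ends T)\<^sup>*" "(tail T e, x) \<in> (arcs_ends T)\<^sup>+" for x
    using that
  proof (induction rule: converse_rtrancl_induct)
    case (step x y)
    then obtain a where a: "a \<in> arcs T" "tail T a = x" "head T a = y"
      by (auto simp: arcs_ends_def arc_to_ends_def)
    have "a \<noteq> e" using step.prems acyclic a by (auto simp: acyclic_def)
    with a have "(x, y) \<in> ?A" by auto
    moreover have "(y, r) \<in> ?A\<^sup>*" using step by (auto intro: trancl_into_trancl)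
    ultimately show ?case by (rule converse_rtrancl_into_rtrancl)
  qed simp
  have ends: "(tail T e, head T a) \<in> arcs_ends T" if "a \<in> {e, f}" for a
    using that e f tails by (auto simp: arcs_ends_def arc_to_ends_def intro!: image_eqI[of _ _ a])
  have to_root: "(head T a, r) \<in> ?A\<^sup>*" if "a \<in> {e, f}" for a
    using that e f ends[OF that] by (intro avoid rooted_tree_reaches_root[OF T r]) auto
  have "(tail T e, head T f) \<in> ?A" using f tails \<open>e \<noteq> f\<close> by auto
  then have "(tail T e, r) \<in> ?A\<^sup>*" using to_root[of f] by (auto intro: converse_rtrancl_into_rtrancl)
  then have "(r, tail T e) \<in> (?A\<inverse>)\<^sup>*" by (simp add: rtrancl_converse)
  then have "(r, tail T e) \<in> (?A \<union> ?A\<inverse>)\<^sup>*" by (rule subsetD[OF rtrancl_mono, rotated]) blast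
  moreover have "(head T e, r) \<in> (?A \<union> ?A\<inverse>)\<^sup>*"
    by (rule subsetD[OF rtrancl_mono to_root]) auto
  ultimately have "(head T e, tail T e) \<in> (?A \<union> ?A\<inverse>)\<^sup>*" by (rule rtrancl_trans[rotated])
  with no_undirected_cycle_imp_bridge[OF wf_digraph_axioms acyc e refl] show False by blast
qed

text \<open>An arrow between two components makes the subquiver induced on their union connected, so
  maximality forces both to be the whole union.\<close>

lemma connected_components_arc:
  assumes H: "H \<in> connected_components G" and H': "H' \<in> connected_components G"
    and e: "e \<in> arcs G" and ends: "tail G e \<in> verts H" "head G e \<in> verts H'"
  shows "verts H = verts H'"
proof -
  have ind: "induced_subgraph H G" "induced_subgraph H' G" and conn: "connected H" "connected H'"
    using H H' by (auto simp: connected_components_def)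
  interpret wf_digraph G using ind by (auto simp: induced_subgraph_def subgraph_def)
  let ?U = "G \<restriction> (verts H \<union> verts H')"
  let ?S = "with_proj (mk_symmetric ?U)"
  interpret U: wf_digraph ?U by (rule wellformed_induce_subgraph)
  interpret S: wf_digraph ?S
    by unfold_locales (auto simp: mk_symmetric_def)
  have sub: "verts H \<subseteq> verts G" "verts H' \<subseteq> verts G"
    using ind by (auto simp: induced_subgraph_def subgraph_def)
  have U: "induced_subgraph ?U G" using sub by (intro induced_induce) auto
  \<comment> \<open>Undirected walks inside either component survive in the larger induced
    subquiver.\<close>
  have inside: "u \<rightarrow>\<^sup>*\<^bsub>?S\<^esub> v" if K: "K \<in> {H, H'}" and uv: "u \<in> verts K" "v \<in> verts K" for K u v
  proof -
    have "u \<rightarrow>\<^sup>*\<^bsub>with_proj (mk_symmetric K)\<^esub> v"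
      using conn K uv by (auto simp: connected_def strongly_connected_def mk_symmetric_def)
    then show ?thesis
      unfolding reachable_def
      by (rule rtrancl_on_mono[rotated 2])
        (use K ind in \<open>auto simp: mk_symmetric_def arcs_ends_def arc_to_ends_def induced_subgraph_def
           subgraph_def compatible_def\<close>)
  qed
  have step: "tail G e \<rightarrow>\<^bsub>?S\<^esub> head G e" "head G e \<rightarrow>\<^bsub>?S\<^esub> tail G e"
    using e ends by (force simp: mk_symmetric_def arcs_ends_def arc_to_ends_def)+
  \<comment> \<open>Strong connectedness is reduced to joining every vertex with
    \<open>tail G e\<close> in both directions; vertices of \<open>H'\<close> get there across
    \<open>e\<close>.\<close>
  have hub: "u \<rightarrow>\<^sup>*\<^bsub>?S\<^esub> tail G e \<and> tail G e \<rightarrow>\<^sup>*\<^bsub>?S\<^esub> u" if "u \<in> verts ?S" for u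
  proof -
    have "u \<in> verts H \<or> u \<in> verts H'" using that by (simp add: mk_symmetric_def)
    then show ?thesis
      using inside[of H u "tail G e"] inside[of H "tail G e" u]
        inside[of H' u "head G e"] inside[of H' "head G e" u] ends step
      by (auto intro: S.reachable_trans S.reachable_adj_trans S.adj_reachable_trans)
  qed
  then have "strongly_connected ?S"
    using ends hub S.reachable_trans by (intro strongly_connectedI) (simp_all, blast+)
  then have "connected ?U" by (simp add: connected_def)
  with U H H' have "\<not> verts H \<subset> verts ?U" "\<not> verts H' \<subset> verts ?U"
    unfolding connected_components_def by blast+
  then show ?thesis by auto
qed

section \<open>Representations and tree modules\<close>

lemma sum_fun_apply: "(\<Sum>a\<in>A. f a) x = (\<Sum>a\<in>A. f a x)"
  by (induction A rule: infinite_finite_induct) auto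

lemma linear_between_zero:
  assumes "linear_between s t A B f" "0 \<in> A"
  shows "f 0 = 0"
proof -
  have "f (0 + 0) = f 0 + f 0" using assms unfolding linear_between_def by blast
  then show ?thesis by simp
qed

lemma linear_between_span:
  assumes "vector_space s" "vector_space t" and f: "linear_between s t A C f"
    and A: "module.span s B = A"
  shows "f ` A \<subseteq> module.span t (f ` B)"
proof -
  interpret V: vector_space s by fact
  interpret W: vector_space t by fact
  have sub: "V.subspace A" "B \<subseteq> A" using A V.subspace_span[of B] V.span_superset[of B] by auto
  have "x \<in> A \<and> f x \<in> W.span (f ` B)" if "x \<in> V.span B" for x
    using that
  proof (induction rule: V.span_induct_alt)
    case base
    show ?case
      using linear_between_zero[OF f] V.subspace_0[OF sub(1)] by (simp add: W.span_zero)
  next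
    case (step c x y)
    then have x: "x \<in> A" "s c x \<in> A" and y: "y \<in> A" "f y \<in> W.span (f ` B)"
      using sub by (auto intro: V.subspace_scale)
    have "f (s c x + y) = t c (f x) + f y" using f x y by (simp add: linear_between_def)
    with step x y sub show ?case
      by (auto intro: V.subspace_add W.span_add W.span_scale W.span_base)
  qed
  with A show ?thesis by blast
qed

text \<open>Compatibility with single arrows iterates along a walk. This is how the vanishing of
  relations passes from one representation to another.\<close>

lemma rep_hom_path_map:
  assumes "wf_digraph Q" and V: "fd_representation Q \<rho> V" and hom: "rep_hom Q V W \<phi>"
    and p: "p \<in> qpaths Q" and x: "x \<in> rep_space V (fst p)"
  shows "rep_path_map V p x \<in> rep_space V (qpath_end Q p)"
    and "rep_path_map W p (\<phi> (fst p) x) = \<phi> (qpath_end Q p) (rep_path_map V p x)"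
proof -
  interpret wf_digraph Q by fact
  have "fold (rep_map V) as x \<in> rep_space V v \<and>
      fold (rep_map W) as (\<phi> u x) = \<phi> v (fold (rep_map V) as x)"
    if "awalk u as v" "x \<in> rep_space V u" for u as v x
    using that
  proof (induction as arbitrary: u x)
    case (Cons a as)
    then have a: "a \<in> arcs Q" "tail Q a = u" and as: "awalk (head Q a) as v"
      by (auto simp: awalk_Cons_iff)
    have "rep_map V a x \<in> rep_space V (head Q a)"
      using V a Cons.prems(2) by (auto simp: fd_representation_def linear_between_def)
    moreover have "rep_map W a (\<phi> u x) = \<phi> (head Q a) (rep_map V a x)"
      using hom a Cons.prems(2) by (auto simp: rep_hom_def)
    ultimately show ?case using Cons.IH[OF as] by simp
  qed (simp add: awalk_Nil_iff)
  from this[of "fst p" "snd p" "qpath_end Q p" x] p x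
  show "rep_path_map V p x \<in> rep_space V (qpath_end Q p)"
    and "rep_path_map W p (\<phi> (fst p) x) = \<phi> (qpath_end Q p) (rep_path_map V p x)"
    by (simp_all add: qpaths_def rep_path_map_def)
qed

text \<open>The relations, finite dimensionality and finite support are transported along the
  isomorphism.\<close>

lemma rep_isoI:
  assumes Q: "wf_digraph Q" "\<rho> \<subseteq> qpaths Q" and V: "fd_representation Q \<rho> V"
    and vs: "vector_space (rep_scale W)"
    and sub: "\<And>i. i \<in> verts Q \<Longrightarrow> module.subspace (rep_scale W) (rep_space W i)"
    and maps: "\<And>a. a \<in> arcs Q \<Longrightarrow> linear_between (rep_scale W) (rep_scale W)
       (rep_space W (tail Q a)) (rep_space W (head Q a)) (rep_map W a)"
    and hom: "rep_hom Q V W \<phi>"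
    and bij: "\<And>i. i \<in> verts Q \<Longrightarrow> bij_betw (\<phi> i) (rep_space V i) (rep_space W i)"
  shows "rep_iso Q \<rho> V W"
proof -
  interpret wf_digraph Q by fact
  interpret V: vector_space "rep_scale V" using V by (simp add: fd_representation_def)
  interpret W: vector_space "rep_scale W" by fact
  have lin: "linear_between (rep_scale V) (rep_scale W) (rep_space V i) (rep_space W i) (\<phi> i)"
    if "i \<in> verts Q" for i using hom that by (simp add: rep_hom_def)
  have zero: "0 \<in> rep_space V i" "\<phi> i 0 = 0" if "i \<in> verts Q" for i
    using V that linear_between_zero[OF lin[OF that]]
    by (auto simp: fd_representation_def V.subspace_0)
  \<comment> \<open>Every \<open>y\<close> comes from some \<open>x\<close> in \<open>V\<close>,
    where the relation already annihilates \<open>x\<close>.\<close>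
  have relations: "rep_path_map W p y = 0" if p: "p \<in> \<rho>" and y: "y \<in> rep_space W (fst p)" for p y
  proof -
    have pQ: "p \<in> qpaths Q" using p Q by blast
    then have ends: "fst p \<in> verts Q" "qpath_end Q p \<in> verts Q"
      by (auto simp: qpaths_def)
    obtain x where x: "x \<in> rep_space V (fst p)" "y = \<phi> (fst p) x"
      using bij[OF ends(1)] y by (auto simp: bij_betw_def)
    have "rep_path_map V p x = 0" using V p x by (simp add: fd_representation_def)
    with rep_hom_path_map(2)[OF Q(1) V hom pQ x(1)] x zero ends show ?thesis by simp
  qed
  have findim: "\<exists>B. finite B \<and> W.span B = rep_space W i" if i: "i \<in> verts Q" for i
  proof -
    obtain B where B: "finite B" "V.span B = rep_space V i"
      using V i by (auto simp: fd_representation_def)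
    have "rep_space W i \<subseteq> W.span (\<phi> i ` B)"
      using linear_between_span[OF V.vector_space_axioms vs lin[OF i] B(2)] bij[OF i]
      by (simp add: bij_betw_def)
    moreover have "\<phi> i ` B \<subseteq> rep_space W i"
      using B V.span_superset[of B] bij[OF i] by (auto simp: bij_betw_def)
    ultimately have "W.span (\<phi> i ` B) = rep_space W i"
      using W.span_minimal[OF _ sub[OF i]] by blast
    with B show ?thesis by blast
  qed
  have "rep_space V i \<noteq> {0}" if "i \<in> verts Q" "rep_space W i \<noteq> {0}" for i
    using that bij[OF that(1)] zero[OF that(1)] by (auto simp: bij_betw_def)
  then have "finite {i \<in> verts Q. rep_space W i \<noteq> {0}}"
    using V by (auto simp: fd_representation_def elim!: rev_finite_subset)
  with vs sub maps relations findim have "fd_representation Q \<rho> W"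
    by (simp add: fd_representation_def)
  with V hom bij show ?thesis by (auto simp: rep_iso_def)
qed

section \<open>Direct sums of representations\<close>

lemma rep_sum_simps [simp]:
  "rep_scale (rep_sum J N) = (\<lambda>c x j. rep_scale (N j) c (x j))"
  "rep_space (rep_sum J N) i =
     {x. (\<forall>j\<in>J. x j \<in> rep_space (N j) i) \<and> (\<forall>j. j \<notin> J \<longrightarrow> x j = 0)}"
  "rep_map (rep_sum J N) a = (\<lambda>x j. if j \<in> J then rep_map (N j) a (x j) else 0)"
  by (simp_all add: rep_sum_def fun_eq_iff)

lemma vector_space_rep_sum:
  assumes "\<And>j. vector_space (rep_scale (N j))"
  shows "vector_space (rep_scale (rep_sum J N))"
  using assms by (simp add: vector_space_def fun_eq_iff)

lemma subspace_rep_sum: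
  assumes vs: "\<And>j. vector_space (rep_scale (N j))"
    and "\<And>j. j \<in> J \<Longrightarrow> module.subspace (rep_scale (N j)) (rep_space (N j) i)"
  shows "module.subspace (rep_scale (rep_sum J N)) (rep_space (rep_sum J N) i)"
proof -
  interpret S: vector_space "rep_scale (rep_sum J N)" by (rule vector_space_rep_sum) fact
  have m: "module (rep_scale (N j))" for j using vs by (simp add: module_iff_vector_space)
  show ?thesis
    unfolding S.subspace_def
    using assms(2) module.scale_zero_right[OF m] by (auto simp: module.subspace_def[OF m])
qed

lemma linear_between_rep_sum:
  assumes "\<And>j. vector_space (rep_scale (N j))"
    and "\<And>j. j \<in> J \<Longrightarrow> linear_between (rep_scale (N j)) (rep_scale (N j))
           (rep_space (N j) u) (rep_space (N j) v) (rep_map (N j) a)"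
  shows "linear_between (rep_scale (rep_sum J N)) (rep_scale (rep_sum J N))
           (rep_space (rep_sum J N) u) (rep_space (rep_sum J N) v) (rep_map (rep_sum J N) a)"
proof -
  have "rep_scale (N j) c 0 = 0" for j c
    using assms(1)[of j] by (intro module.scale_zero_right) (simp add: module_iff_vector_space)
  with assms(2) show ?thesis by (auto simp: linear_between_def fun_eq_iff)
qed

section \<open>Tree modules as representations\<close>

lemma tree_module_simps [simp]:
  "rep_scale (tree_module T F) = (\<lambda>c x n. c * x n)"
  "rep_space (tree_module T F) i = {x. \<forall>n. x n \<noteq> 0 \<longrightarrow> n \<in> verts T \<and> vmap F n = i}"
  by (simp_all add: tree_module_def)

text \<open>The definition sums over the tails of arrows; regrouping by heads gives the coefficient
  at \<open>m\<close>, the form in which all later computations with arrows take place.\<close>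

lemma rep_map_tree_module:
  assumes "fin_digraph T"
  shows "rep_map (tree_module T F) \<gamma> x m =
    (\<Sum>e\<in>{e \<in> arcs T. head T e = m \<and> amap F e = \<gamma>}. x (tail T e))"
proof -
  interpret fin_digraph T by fact
  let ?A = "{e \<in> arcs T. amap F e = \<gamma>}"
  have "rep_map (tree_module T F) \<gamma> x m =
      (\<Sum>n\<in>verts T. \<Sum>e\<in>{e \<in> ?A. tail T e = n}. if head T e = m then x (tail T e) else 0)"
    unfolding tree_module_def
    by (auto simp: sum_fun_apply sum_distrib_left basis_vec_def intro!: sum.cong)
  also have "\<dots> = (\<Sum>e\<in>?A. if head T e = m then x (tail T e) else 0)"
    by (intro sum.group) auto
  also have "\<dots> = (\<Sum>e\<in>{e \<in> ?A. head T e = m}. x (tail T e))"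
    by (subst sum.inter_filter) auto
  also have "{e \<in> ?A. head T e = m} = {e \<in> arcs T. head T e = m \<and> amap F e = \<gamma>}" by auto
  finally show ?thesis .
qed

lemma vector_space_tree_module: "vector_space (rep_scale (tree_module T F))"
  by unfold_locales (auto simp: fun_eq_iff algebra_simps)

lemma subspace_tree_module:
  "module.subspace (rep_scale (tree_module T F)) (rep_space (tree_module T F) i)"
proof -
  interpret vector_space "rep_scale (tree_module T F)" by (rule vector_space_tree_module)
  show ?thesis unfolding subspace_def by (auto, (metis add_0)+)
qed

lemma linear_between_tree_module:
  assumes T: "fin_digraph T" and F: "quiver_morphism T Q F"
  shows "linear_between (rep_scale (tree_module T F)) (rep_scale (tree_module T F))
    (rep_space (tree_module T F) (tail Q a)) (rep_space (tree_module T F) (head Q a))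
    (rep_map (tree_module T F) a)"
proof -
  interpret fin_digraph T by fact
  have "m \<in> verts T \<and> vmap F m = head Q a" if nz: "rep_map (tree_module T F) a x m \<noteq> 0" for x m
  proof -
    obtain e where "e \<in> arcs T" "head T e = m" "amap F e = a"
      using sum.not_neutral_contains_not_neutral[OF nz[unfolded rep_map_tree_module[OF T]]] by blast
    with F show ?thesis by (auto simp: quiver_morphism_def)
  qed
  then show ?thesis
    by (auto simp: linear_between_def fun_eq_iff rep_map_tree_module[OF T] sum.distrib sum_distrib_left)
qed

text \<open>A nonzero coefficient can be traced back one arrow at a time, which lifts the word of
  labels to a walk in \<open>T\<close>. The support condition makes the trivial walk of the base
  case start at a vertex of \<open>T\<close>.\<close>

lemma rep_path_map_tree_module_nonzero:
  assumes T: "fin_digraph T" and nz: "rep_path_map (tree_module T F) p x m \<noteq> 0"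
    and x: "\<And>n. x n \<noteq> 0 \<Longrightarrow> n \<in> verts T"
  obtains n as where "x n \<noteq> 0" "pre_digraph.awalk T n as m" "map (amap F) as = snd p"
proof -
  interpret fin_digraph T by fact
  have "\<exists>n as. x n \<noteq> 0 \<and> awalk n as m \<and> map (amap F) as = bs"
    if "fold (rep_map (tree_module T F)) bs x m \<noteq> 0" "\<And>n. x n \<noteq> 0 \<Longrightarrow> n \<in> verts T" for bs x
    using that
  proof (induction bs arbitrary: x)
    case Nil
    then show ?case by (auto simp: awalk_Nil_iff)
  next
    case (Cons b bs)
    let ?y = "rep_map (tree_module T F) b x"
    have arc: "\<exists>e. e \<in> arcs T \<and> head T e = n \<and> amap F e = b \<and> x (tail T e) \<noteq> 0"
      if nz: "?y n \<noteq> 0" for n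
      using sum.not_neutral_contains_not_neutral[OF nz[unfolded rep_map_tree_module[OF T]]] by blast
    have "fold (rep_map (tree_module T F)) bs ?y m \<noteq> 0" using Cons.prems by simp
    from Cons.IH[OF this] arc obtain n as where
      n: "?y n \<noteq> 0" "awalk n as m" "map (amap F) as = bs" by fastforce
    from arc[OF n(1)] obtain e where
      "e \<in> arcs T" "head T e = n" "amap F e = b" "x (tail T e) \<noteq> 0" by blast
    with n show ?case
      by (intro exI[of _ "tail T e"] exI[of _ "e # as"]) (auto simp: awalk_Cons_iff)
  qed
  from this[of "snd p" x] nz x that show thesis by (auto simp: rep_path_map_def)
qed

text \<open>If a relation \<open>p\<close> acted nontrivially, it would lift to a path in
  \<open>T\<close> with image exactly \<open>p\<close>, a generator of the ideal. A bound morphism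
  excludes this.\<close>

lemma tree_module_relations:
  fixes F :: "('n, 'e, 'q, 'a) quiver_map" and x :: "'n \<Rightarrow> 'k::field"
  assumes T: "fin_digraph T" and F: "bound_morphism TYPE('k) T Q \<rho> F"
    and p: "p \<in> \<rho>" and x: "x \<in> rep_space (tree_module T F) (fst p)"
  shows "rep_path_map (tree_module T F) p x = 0"
proof (rule ccontr)
  interpret fin_digraph T by fact
  assume "rep_path_map (tree_module T F) p x \<noteq> 0"
  then obtain m where "rep_path_map (tree_module T F) p x m \<noteq> 0" by (auto simp: fun_eq_iff)
  then obtain n as where n: "x n \<noteq> 0" "awalk n as m" "map (amap F) as = snd p"
    by (rule rep_path_map_tree_module_nonzero[OF T]) (use x in auto)
  then have "(n, as) \<in> qpaths T" by (auto simp: qpaths_def qpath_end_def)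
  moreover have "map_qpath F (n, as) = p" using n x by (auto simp: map_qpath_def prod_eq_iff)
  moreover have "(path_elem p :: ('q, 'a) qpath \<Rightarrow>\<^sub>0 'k) \<in> generated_ideal Q \<rho>"
    using p by (auto simp: generated_ideal_def)
  ultimately show False using F by (auto simp: bound_morphism_def)
qed

lemma span_tree_module:
  assumes "fin_digraph T"
  shows "module.span (rep_scale (tree_module T F)) (basis_vec ` {n \<in> verts T. vmap F n = i})
    = rep_space (tree_module T F) i"
proof
  interpret fin_digraph T by fact
  interpret vector_space "rep_scale (tree_module T F)" by (rule vector_space_tree_module)
  let ?V = "{n \<in> verts T. vmap F n = i}"
  show "span (basis_vec ` ?V) \<subseteq> rep_space (tree_module T F) i"
    by (rule span_minimal[OF _ subspace_tree_module]) (auto simp: basis_vec_def split: if_splits)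
  show "rep_space (tree_module T F) i \<subseteq> span (basis_vec ` ?V)"
  proof
    fix x assume x: "x \<in> rep_space (tree_module T F) i"
    have "x m = (\<Sum>n\<in>?V. x n * basis_vec n m)" for m
    proof (cases "m \<in> ?V")
      case True
      then have "(\<Sum>n\<in>?V. x n * basis_vec n m) = (\<Sum>n\<in>?V. if m = n then x n else 0)"
        by (intro sum.cong) (simp_all add: basis_vec_def)
      also have "\<dots> = x m" using True by (subst sum.delta') auto
      finally show ?thesis ..
    next
      case False
      then have "x m = 0" using x by auto
      moreover have "(\<Sum>n\<in>?V. x n * basis_vec n m) = 0"
        using False by (intro sum.neutral) (auto simp: basis_vec_def)
      ultimately show ?thesis by simp
    qed
    then have "x = (\<Sum>n\<in>?V. rep_scale (tree_module T F) (x n) (basis_vec n))"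
      unfolding tree_module_simps fun_eq_iff sum_fun_apply by blast
    also have "\<dots> \<in> span (basis_vec ` ?V)"
      by (intro span_sum span_scale span_base) auto
    finally show "x \<in> span (basis_vec ` ?V)" .
  qed
qed

lemma fd_representation_tree_module:
  fixes F :: "('n, 'e, 'q, 'a) quiver_map" and M :: "('q, 'a, 'k::field, 'n \<Rightarrow> 'k) quiver_rep"
  assumes T: "fin_digraph T" and F: "bound_morphism TYPE('k) T Q \<rho> F"
    and M: "M = tree_module T F"
  shows "fd_representation Q \<rho> M"
proof -
  interpret fin_digraph T by fact
  have "{i \<in> verts Q. rep_space M i \<noteq> {0}} \<subseteq> vmap F ` verts T"
    by (auto simp: M fun_eq_iff) (metis image_eqI)
  then have "finite {i \<in> verts Q. rep_space M i \<noteq> {0}}"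
    by (rule finite_subset) simp
  moreover have "\<exists>B. finite B \<and> module.span (rep_scale M) B = rep_space M i" for i
    unfolding M using span_tree_module[OF T, of F i]
    by (intro exI[of _ "basis_vec ` {n \<in> verts T. vmap F n = i}"]) auto
  moreover have "rep_path_map M p x = 0" if "p \<in> \<rho>" "x \<in> rep_space M (fst p)" for p x
    using tree_module_relations[OF T F] that by (simp only: M)
  moreover have "linear_between (rep_scale M) (rep_scale M) (rep_space M (tail Q a))
      (rep_space M (head Q a)) (rep_map M a)" for a
    using F unfolding M bound_morphism_def by (intro linear_between_tree_module[OF T]) blast
  moreover have "vector_space (rep_scale M)" unfolding M by (rule vector_space_tree_module)
  moreover have "module.subspace (rep_scale M) (rep_space M i)" for i
    unfolding M by (rule subspace_tree_module)
  ultimately show ?thesis by (simp only: fd_representation_def) blast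
qed

section \<open>Retractions of rooted trees\<close>

text \<open>The combinatorics of \<iota> on \<open>T\<close> alone; the labelling \<open>F\<close>
  enters only where tree modules do.\<close>

locale rooted_tree_retraction =
  fixes T :: "('n, 'e) pre_digraph" and \<iota> :: "('n, 'e, 'n, 'e) quiver_map"
  assumes T: "rooted_tree T" and \<iota>: "quiver_morphism T T \<iota>"
    and idem: "quiver_map_eq T (quiver_comp \<iota> \<iota>) \<iota>"
begin

sublocale fin_digraph T
  using T by (simp add: rooted_tree_def tree_quiver_def)

lemma verts_map: "n \<in> verts T \<Longrightarrow> vmap \<iota> n \<in> verts T"
  and arcs_map: "e \<in> arcs T \<Longrightarrow> amap \<iota> e \<in> arcs T"
  and tail_map: "e \<in> arcs T \<Longrightarrow> tail T (amap \<iota> e) = vmap \<iota> (tail T e)"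
  and head_map: "e \<in> arcs T \<Longrightarrow> head T (amap \<iota> e) = vmap \<iota> (head T e)"
  using \<iota> by (auto simp: quiver_morphism_def)

lemma map_in_fixed: "n \<in> verts T \<Longrightarrow> vmap \<iota> n \<in> fixed_verts T \<iota>"
  using idem verts_map by (auto simp: quiver_map_eq_def quiver_comp_def fixed_verts_def)

text \<open>The image of \<open>e\<close> under \<iota> starts at the same fixed vertex as
  \<open>e\<close>, so uniqueness of outgoing arrows makes \<open>e\<close> itself fixed.\<close>

lemma fixed_arc_closed:
  assumes e: "e \<in> arcs T" and "tail T e \<in> fixed_verts T \<iota>"
  shows "head T e \<in> fixed_verts T \<iota>"
proof -
  have "amap \<iota> e = e"
    using assms by (intro rooted_tree_unique_out_arc[OF T]) (auto simp: arcs_map tail_map fixed_verts_def)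
  with head_map[OF e] e show ?thesis by (simp add: fixed_verts_def)
qed

text \<open>The path from \<open>\<iota> r\<close> to the root \<open>r\<close> is mapped to a path from \<open>\<iota> r\<close> to itself.\<close>

lemma map_root:
  assumes r: "r \<in> verts T" "out_arcs T r = {}"
  shows "vmap \<iota> r = r"
proof (rule ccontr)
  assume "vmap \<iota> r \<noteq> r"
  then have "(vmap \<iota> r, r) \<in> (arcs_ends T)\<^sup>+"
    using rooted_tree_reaches_root[OF T r verts_map[OF r(1)]] by (auto dest: rtranclD)
  moreover have "(vmap \<iota> u, vmap \<iota> v) \<in> (arcs_ends T)\<^sup>+" if "(u, v) \<in> (arcs_ends T)\<^sup>+" for u v
  proof -
    have arc: "(vmap \<iota> x, vmap \<iota> y) \<in> arcs_ends T" if xy: "(x, y) \<in> arcs_ends T" for x y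
    proof -
      obtain e where "e \<in> arcs T" "tail T e = x" "head T e = y"
        using xy by (auto simp: arcs_ends_def arc_to_ends_def)
      then have "(vmap \<iota> x, vmap \<iota> y) = arc_to_ends T (amap \<iota> e)" "amap \<iota> e \<in> arcs T"
        by (simp_all add: arc_to_ends_def arcs_map tail_map head_map)
      then show ?thesis by (simp add: arcs_ends_def)
    qed
    show ?thesis using that by induction (auto intro: arc trancl_into_trancl)
  qed
  ultimately have "(vmap \<iota> (vmap \<iota> r), vmap \<iota> r) \<in> (arcs_ends T)\<^sup>+" by blast
  moreover have "vmap \<iota> (vmap \<iota> r) = vmap \<iota> r"
    using map_in_fixed[OF r(1)] by (simp add: fixed_verts_def)
  moreover have "acyclic (arcs_ends T)"
    using T wf_digraph_axioms
    by (intro no_undirected_cycle_imp_acyclic) (auto simp: rooted_tree_def tree_quiver_def)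
  ultimately show False by (simp add: acyclic_def)
qed

text \<open>As \<iota> fixes the root, a vertex whose image has an outgoing arrow is not the root.
  Its own outgoing arrow must then be mapped to the only arrow leaving the image.\<close>

lemma lift_arc:
  assumes n: "n \<in> verts T" and e: "e \<in> arcs T" "tail T e = vmap \<iota> n"
  obtains d where "d \<in> arcs T" "tail T d = n" "amap \<iota> d = e"
proof -
  have "out_arcs T n \<noteq> {}"
  proof
    assume "out_arcs T n = {}"
    with map_root[OF n] e show False by (auto simp: out_arcs_def)
  qed
  then obtain d where d: "d \<in> arcs T" "tail T d = n" by (auto simp: out_arcs_def)
  then have "amap \<iota> d = e"
    using e by (intro rooted_tree_unique_out_arc[OF T]) (simp_all add: arcs_map tail_map)
  with d that show thesis by blast
qed

text \<open>By \<open>lift_arc\<close>, both sides sum over the arrows \<open>e\<close> with label \<open>\<gamma>\<close> and \<open>\<iota> (head e) = m\<close>.\<close>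

lemma sum_fibres_rep_map_tree_module:
  assumes F\<iota>: "quiver_map_eq T (quiver_comp F \<iota>) F"
  shows "(\<Sum>n\<in>{n \<in> verts T. vmap \<iota> n = m}. rep_map (tree_module T F) \<gamma> x n) =
    rep_map (tree_module (T \<restriction> fixed_verts T \<iota>) F) \<gamma>
      (\<lambda>m. \<Sum>n\<in>{n \<in> verts T. vmap \<iota> n = m}. x n) m"
proof -
  let ?D = "{e \<in> arcs T. vmap \<iota> (head T e) = m \<and> amap F e = \<gamma>}"
  let ?E = "{e \<in> arcs (T \<restriction> fixed_verts T \<iota>). head T e = m \<and> amap F e = \<gamma>}"
  have F_arc: "amap F (amap \<iota> e) = amap F e" if "e \<in> arcs T" for e
    using F\<iota> that by (simp add: quiver_map_eq_def quiver_comp_def)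
  have fin: "fin_digraph (T \<restriction> fixed_verts T \<iota>)"
    by (intro fin_digraph_subgraph induced_imp_subgraph induced_induce) (auto simp: fixed_verts_def)
  have "(\<Sum>n\<in>{n \<in> verts T. vmap \<iota> n = m}. rep_map (tree_module T F) \<gamma> x n) =
      (\<Sum>n\<in>{n \<in> verts T. vmap \<iota> n = m}. \<Sum>e\<in>{e \<in> ?D. head T e = n}. x (tail T e))"
    by (auto simp: rep_map_tree_module[OF fin_digraph_axioms] intro!: sum.cong)
  also have "\<dots> = (\<Sum>e\<in>?D. x (tail T e))"
    by (intro sum.group) auto
  \<comment> \<open>Since \<iota> preserves labels and has its image in the fixed part, it maps
    \<open>?D\<close> into \<open>?E\<close>.\<close>
  also have "\<dots> = (\<Sum>d\<in>?E. \<Sum>e\<in>{e \<in> ?D. amap \<iota> e = d}. x (tail T e))"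
    by (intro sum.group[symmetric]) (auto simp: arcs_map tail_map head_map F_arc map_in_fixed)
  \<comment> \<open>Each vertex over \<open>tail T d\<close> is the tail of exactly one arrow over
    \<open>d\<close>: \<open>lift_arc\<close> gives existence, and uniqueness of outgoing arrows
    gives injectivity of \<open>tail T\<close>.\<close>
  also have "\<dots> = (\<Sum>d\<in>?E. \<Sum>n\<in>{n \<in> verts T. vmap \<iota> n = tail T d}. x n)"
  proof (intro sum.cong refl sum.reindex_bij_betw bij_betw_imageI)
    fix d assume d: "d \<in> ?E"
    show "inj_on (tail T) {e \<in> ?D. amap \<iota> e = d}"
      by (auto intro!: inj_onI rooted_tree_unique_out_arc[OF T])
    show "tail T ` {e \<in> ?D. amap \<iota> e = d} = {n \<in> verts T. vmap \<iota> n = tail T d}"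
    proof (intro equalityI subsetI)
      fix n assume "n \<in> {n \<in> verts T. vmap \<iota> n = tail T d}"
      then obtain e where "e \<in> arcs T" "tail T e = n" "amap \<iota> e = d"
        using d by (auto elim: lift_arc)
      with d show "n \<in> tail T ` {e \<in> ?D. amap \<iota> e = d}"
        using F_arc[of e] head_map[of e] by force
    qed (auto simp: tail_map)
  qed
  finally show ?thesis by (simp add: rep_map_tree_module[OF fin] conj_ac)
qed

end

theorem lemma3p6:
  fixes Q :: "('q, 'a) pre_digraph" and \<rho> :: "('q, 'a) qpath set"
    and T :: "('n, 'e) pre_digraph" and F :: "('n, 'e, 'q, 'a) quiver_map"
    and \<iota> :: "('n, 'e, 'n, 'e) quiver_map"
    and S :: "nat \<Rightarrow> 'n set" and k :: nat
    and M :: "('q, 'a, 'k::field, 'n \<Rightarrow> 'k) quiver_rep"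
    and N :: "nat \<Rightarrow> ('q, 'a, 'k, 'n \<Rightarrow> 'k) quiver_rep"
  assumes "CHAR('k) \<noteq> 2"
    and "bound_quiver TYPE('k) Q \<rho>"
    and "rooted_tree T"
    and "bound_morphism TYPE('k) T Q \<rho> F"
    and "M = tree_module T F"
    and "quiver_morphism T T \<iota>"
    and "quiver_map_eq T (quiver_comp \<iota> \<iota>) \<iota>"
    and "\<not> quiver_map_eq T \<iota> quiver_id"
    and "quiver_map_eq T (quiver_comp F \<iota>) F"
    and "inj_on S {1..k}"
    and "partition_on (verts T - fixed_verts T \<iota>) (S ` {1..k})"
    and "(\<lambda>j. T \<restriction> S j) ` {1..k} =
           connected_components (T \<restriction> (verts T - fixed_verts T \<iota>))"
    and "N = (\<lambda>j. tree_module (T \<restriction> (if j = 0 then fixed_verts T \<iota> else S j)) F)"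
  shows "rep_iso Q \<rho> M (rep_sum {0..k} N)"
proof -
  interpret rooted_tree_retraction T \<iota> by unfold_locales fact+
  let ?Fix = "fixed_verts T \<iota>"
  let ?fibre = "\<lambda>m. {n \<in> verts T. vmap \<iota> n = m}"
  define X where "X j = (if j = 0 then ?Fix else S j)" for j
  have M: "M = tree_module T F" by fact
  have N: "N j = tree_module (T \<restriction> X j) F" for j using assms(13) by (simp add: X_def)
  have Q: "wf_digraph Q" "\<rho> \<subseteq> qpaths Q" using assms(2) by (auto simp: bound_quiver_def)
  have F: "quiver_morphism T Q F" using assms(4) by (simp add: bound_morphism_def)
  have F_vert: "vmap F (vmap \<iota> n) = vmap F n" if "n \<in> verts T" for n
    using assms(9) that by (simp add: quiver_map_eq_def quiver_comp_def)
  have S_sub: "S j \<subseteq> verts T - ?Fix" if "j \<in> {1..k}" for j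
    using assms(11) that by (auto simp: partition_on_def)
  have "\<exists>j. j \<in> {1..k} \<and> n \<in> S j" if "n \<in> verts T - ?Fix" for n
    using partition_onD1[OF assms(11)] that by blast
  \<comment> \<open>The index of the component containing a moved vertex; \<open>c\<close> is
    unconstrained elsewhere.\<close>
  then obtain c where c: "c n \<in> {1..k}" "n \<in> S (c n)" if "n \<in> verts T - ?Fix" for n
    by metis
  have c_eq: "c n = j" if "j \<in> {1..k}" "n \<in> S j" for n j
  proof -
    have "n \<in> verts T - ?Fix" using S_sub that by blast
    from c[OF this] that have "S (c n) = S j"
      using disjointD[OF partition_onD2[OF assms(11)], of "S (c n)" "S j"] by blast
    with assms(10) c[OF \<open>n \<in> verts T - ?Fix\<close>] that show ?thesis by (auto dest: inj_onD)
  qed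
  have X_sub: "X j \<subseteq> verts T" if "j \<in> {0..k}" for j
    using that S_sub[of j] by (auto simp: X_def fixed_verts_def)
  have finX: "fin_digraph (T \<restriction> X j)" if "j \<in> {0..k}" for j
    by (intro fin_digraph_subgraph induced_imp_subgraph induced_induce X_sub that)
  have FX: "quiver_morphism (T \<restriction> X j) Q F" if "j \<in> {0..k}" for j
    using F X_sub[OF that] by (auto simp: quiver_morphism_def)
  \<comment> \<open>The tail cannot be fixed, because arrows leaving fixed vertices end in fixed
    vertices. Thus \<open>e\<close> lies in the moved part and joins vertices of one
    component.\<close>
  have into: "tail T e \<in> S j" if j: "j \<in> {1..k}" and e: "e \<in> arcs T" "head T e \<in> S j" for j e
  proof -
    have "tail T e \<in> verts T - ?Fix" using fixed_arc_closed[of e] S_sub j e by auto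
    note ct = c[OF this]
    have "verts (T \<restriction> S (c (tail T e))) = verts (T \<restriction> S j)"
      by (rule connected_components_arc[where G = "T \<restriction> (verts T - ?Fix)" and e = e])
        (use assms(12) ct j e S_sub in auto)
    with ct show ?thesis by simp
  qed
  \<comment> \<open>In coordinates, component 0 is the push-forward along \<iota> and the other
    components are restrictions.\<close>
  define \<phi> :: "('n \<Rightarrow> 'k) \<Rightarrow> nat \<Rightarrow> 'n \<Rightarrow> 'k" where
    "\<phi> x j m = (if j = 0 then \<Sum>n\<in>?fibre m. x n else if j \<in> {1..k} \<and> m \<in> S j then x m else 0)"
    for x j m
  \<comment> \<open>The inverse reads off moved coordinates directly. At a fixed vertex it subtracts
    the contributions of the moved vertices in the fibre from component 0.\<close>
  define \<psi> :: "(nat \<Rightarrow> 'n \<Rightarrow> 'k) \<Rightarrow> 'n \<Rightarrow> 'k" where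
    "\<psi> y n = (if n \<in> verts T - ?Fix then y (c n) n
       else y 0 n - (\<Sum>l\<in>?fibre n - {n}. y (c l) l))" for y n
  have space_\<phi>: "\<phi> x \<in> rep_space (rep_sum {0..k} N) i" if x: "x \<in> rep_space M i" for x i
  proof -
    have "m \<in> ?Fix \<and> vmap F m = i" if nz: "(\<Sum>n\<in>?fibre m. x n) \<noteq> 0" for m
    proof -
      obtain n where "n \<in> ?fibre m" "x n \<noteq> 0"
        using sum.not_neutral_contains_not_neutral[OF nz] by blast
      with x show ?thesis using F_vert[of n] map_in_fixed[of n] by (auto simp: M)
    qed
    with x show ?thesis by (auto simp: N M X_def \<phi>_def fun_eq_iff split: if_splits)
  qed
  have fibre_fixed: "?fibre m - {m} \<subseteq> verts T - ?Fix" for m by (auto simp: fixed_verts_def)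
  have space_\<psi>: "\<psi> y \<in> rep_space M i" if y: "y \<in> rep_space (rep_sum {0..k} N) i" for y i
  proof -
    have nz: "n \<in> X j \<and> vmap F n = i" if "y j n \<noteq> 0" "j \<in> {0..k}" for j n
      using y that by (auto simp: N)
    have "n \<in> verts T \<and> vmap F n = i" if n: "\<psi> y n \<noteq> 0" for n
    proof (cases "n \<in> verts T - ?Fix")
      case True
      with n c[OF True] nz[of "c n" n] show ?thesis by (auto simp: \<psi>_def)
    next
      case False
      then have "\<psi> y n = y 0 n - (\<Sum>l\<in>?fibre n - {n}. y (c l) l)"
        by (simp only: \<psi>_def if_False)
      with n consider "y 0 n \<noteq> 0" | "(\<Sum>l\<in>?fibre n - {n}. y (c l) l) \<noteq> 0"
        by fastforce
      then show ?thesis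
      proof cases
        case 1
        with nz[of 0 n] show ?thesis by (auto simp: X_def fixed_verts_def)
      next
        case 2
        then obtain l where l: "l \<in> ?fibre n - {n}" "y (c l) l \<noteq> 0"
          by (rule sum.not_neutral_contains_not_neutral)
        then have "l \<in> verts T - ?Fix" using fibre_fixed by blast
        with l nz[of "c l" l] c[of l] F_vert[of l] verts_map[of l] show ?thesis by auto
      qed
    qed
    then show ?thesis by (simp add: M)
  qed
  have fibre_split: "(\<Sum>n\<in>?fibre m. x n) = x m + (\<Sum>n\<in>?fibre m - {m}. x n)"
    if "m \<in> ?Fix" for m and x :: "'n \<Rightarrow> 'k"
    using that by (intro sum.remove) (auto simp: fixed_verts_def)
  have fibre_empty: "?fibre m = {}" if "m \<notin> ?Fix" for m
    using that map_in_fixed by auto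
  have \<psi>\<phi>: "\<psi> (\<phi> x) = x" if x: "x \<in> rep_space M i" for x i
  proof
    fix n
    have move: "\<phi> x (c l) l = x l" if "l \<in> verts T - ?Fix" for l
      using c[OF that] by (auto simp: \<phi>_def)
    have rest: "(\<Sum>l\<in>?fibre n - {n}. \<phi> x (c l) l) = (\<Sum>l\<in>?fibre n - {n}. x l)"
      using fibre_fixed move by (intro sum.cong) blast+
    show "\<psi> (\<phi> x) n = x n"
    proof (cases "n \<in> verts T - ?Fix")
      case True
      with move show ?thesis by (simp add: \<psi>_def)
    next
      case False
      then have "\<psi> (\<phi> x) n = \<phi> x 0 n - (\<Sum>l\<in>?fibre n - {n}. x l)"
        using rest by (simp only: \<psi>_def if_False)
      \<comment> \<open>Here \<open>n\<close> is neither moved nor fixed, hence no vertex of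
        \<open>T\<close>.\<close>
      moreover have "x n = 0 \<and> ?fibre n = {}" if "n \<notin> ?Fix"
        using False x that fibre_empty by (auto simp: M)
      ultimately show ?thesis
        using fibre_split[of n x] by (cases "n \<in> ?Fix") (simp_all add: \<phi>_def)
    qed
  qed
  have \<phi>\<psi>: "\<phi> (\<psi> y) = y" if y: "y \<in> rep_space (rep_sum {0..k} N) i" for y i
  proof (intro ext)
    fix j m
    have nz: "m \<in> X j" if "y j m \<noteq> 0" "j \<in> {0..k}"
      using y that by (auto simp: N)
    have out: "y j = 0" if "j \<notin> {0..k}" using y that by simp
    show "\<phi> (\<psi> y) j m = y j m"
    proof (cases "j = 0")
      case True
      show ?thesis
      proof (cases "m \<in> ?Fix")
        case m: True
        \<comment> \<open>The rest of the fibre is moved, so this sum cancels the one subtracted in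
          \<open>\<psi> y m\<close>.\<close>
        have "(\<Sum>n\<in>?fibre m - {m}. \<psi> y n) = (\<Sum>n\<in>?fibre m - {m}. y (c n) n)"
          by (intro sum.cong) (auto simp: \<psi>_def fixed_verts_def)
        with True m show ?thesis using fibre_split[OF m, of "\<psi> y"]
          by (simp add: \<phi>_def) (simp add: \<psi>_def)
      next
        case False
        have "\<phi> (\<psi> y) j m = 0" unfolding \<phi>_def fibre_empty[OF False] using True by simp
        moreover have "y j m = 0" using True False nz by (auto simp: X_def)
        ultimately show ?thesis by simp
      qed
    next
      case False
      show ?thesis
      proof (cases "j \<in> {1..k} \<and> m \<in> S j")
        case True
        with False S_sub[of j] c_eq[of j m] show ?thesis by (auto simp: \<phi>_def \<psi>_def)
      next
        case notin: False
        then have "y j m = 0" using False nz out by (cases "j \<in> {0..k}") (auto simp: X_def)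
        with notin False show ?thesis by (auto simp: \<phi>_def)
      qed
    qed
  qed
  have map_\<phi>: "\<phi> (rep_map M a x) = rep_map (rep_sum {0..k} N) a (\<phi> x)" for a x
  proof (intro ext)
    fix j m
    show "\<phi> (rep_map M a x) j m = rep_map (rep_sum {0..k} N) a (\<phi> x) j m"
    proof (cases "j \<in> {1..k}")
      case j: True
      \<comment> \<open>By \<open>into\<close>, passing to the component loses no arrow ending in
        it, so both coefficients run over the same arrows.\<close>
      have "{e \<in> arcs (T \<restriction> S j). head T e = m \<and> amap F e = a} =
          (if m \<in> S j then {e \<in> arcs T. head T e = m \<and> amap F e = a} else {})"
        using into[OF j] by auto
      moreover have "\<phi> x j (tail T e) = x (tail T e)" if "e \<in> arcs T" "head T e \<in> S j" for e
        using into[OF j that] j by (simp add: \<phi>_def)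
      ultimately show ?thesis using j finX[of j]
        by (auto simp: M N X_def rep_map_tree_module rep_map_tree_module[OF fin_digraph_axioms]
            \<phi>_def[of "rep_map (tree_module T F) a x"] intro!: sum.cong)
    next
      case False
      have "\<phi> x 0 = (\<lambda>m. \<Sum>n\<in>?fibre m. x n)" by (simp add: \<phi>_def fun_eq_iff)
      show ?thesis
      proof (cases "j = 0")
        case True
        have "\<phi> (rep_map M a x) 0 m = (\<Sum>n\<in>?fibre m. rep_map M a x n)"
          by (simp add: \<phi>_def)
        with True \<open>\<phi> x 0 = _\<close> show ?thesis
          using sum_fibres_rep_map_tree_module[OF assms(9), where m = m and \<gamma> = a and x = x]
          by (simp add: M N X_def)
      next
        case j: False
        with False show ?thesis by (auto simp: \<phi>_def)
      qed
    qed
  qed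
  have lin_\<phi>: "\<phi> (x + y) = \<phi> x + \<phi> y" 
    "\<phi> (rep_scale M b x) = rep_scale (rep_sum {0..k} N) b (\<phi> x)" for x y b
    by (auto simp: M N \<phi>_def fun_eq_iff sum.distrib sum_distrib_left)
  show ?thesis
  \<comment> \<open>One map serves all vertices of \<open>Q\<close>: it is defined on all
    coefficient functions and respects the grading by \<open>F\<close>.\<close>
  proof (rule rep_isoI[OF Q, where \<phi> = "\<lambda>_. \<phi>"])
    show "fd_representation Q \<rho> M"
      by (rule fd_representation_tree_module[OF fin_digraph_axioms assms(4) M])
    show "vector_space (rep_scale (rep_sum {0..k} N))"
      by (rule vector_space_rep_sum) (simp only: N vector_space_tree_module)
    show "module.subspace (rep_scale (rep_sum {0..k} N)) (rep_space (rep_sum {0..k} N) i)" for i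
      by (rule subspace_rep_sum) (simp_all only: N vector_space_tree_module subspace_tree_module)
    show "linear_between (rep_scale (rep_sum {0..k} N)) (rep_scale (rep_sum {0..k} N))
        (rep_space (rep_sum {0..k} N) (tail Q a)) (rep_space (rep_sum {0..k} N) (head Q a))
        (rep_map (rep_sum {0..k} N) a)" for a
      using finX FX
      by (intro linear_between_rep_sum)
        (simp_all only: N vector_space_tree_module linear_between_tree_module)
    show "rep_hom Q M (rep_sum {0..k} N) (\<lambda>_. \<phi>)"
      unfolding rep_hom_def linear_between_def
      by (intro conjI ballI allI space_\<phi> map_\<phi> lin_\<phi>)
    show "bij_betw \<phi> (rep_space M i) (rep_space (rep_sum {0..k} N) i)" for i
      by (rule bij_betw_byWitness[where f' = \<psi>])
        (use space_\<phi> space_\<psi> \<psi>\<phi> \<phi>\<psi> in \<open>blast+\<close>)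
  qed
qed

end
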